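(* Let $\alpha\in[0,1]$ be real. Let $G_1$ and $G_2$ be two $A_\alpha$-cospectral graphs of order $n$, and let $H_1,H_2,\ldots,H_n$ be $n$ graphs with the same order $q$ and the same $A_\alpha$-coronal, i.e. $\chi_{A_\alpha(H_1)}(\lambda)=\cdots=\chi_{A_\alpha(H_n)}(\lambda)$. Then the generalized coronas $G_1\tilde{o}\wedge_{i=1}^n H_i$ and $G_2\tilde{o}\wedge_{i=1}^n H_i$ are $A_\alpha$-cospectral.
   Context: All graphs are finite, simple and undirected. For a graph $G$ with adjacency matrix $A(G)$ and diagonal degree matrix $D(G)$, and real $\alpha\in[0,1]$, $A_\alpha(G)=\alpha D(G)+(1-\alpha)A(G)$. Two non-isomorphic graphs are said to be $A_\alpha$-cospectral if they have the same $A_\alpha$-spectrum, i.e. the same multiset of eigenvalues of $A_\alpha$. The generalized corona $G\tilde{o}\wedge_{i=1}^n H_i$ (where $n=|V(G)|$) is the graph obtained by taking one copy of each of $G,H_1,\ldots,H_n$ (pairwise disjoint) and joining the $i$th vertex of $G$ to every vertex of $H_i$, for $1\le i\le n$. The $A_\alpha$-coronal of a graph $H$ of order $t$ is the rational function $\chi_{A_\alpha(H)}(\lambda)=\mathbf{1}_t^T\big((\lambda-\alpha)I_t-A_\alpha(H)\big)^{-1}\mathbf{1}_t$, where $\mathbf{1}_t$ is the all-ones column vector. *)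

theory Defs
  imports
    "Graph_Theory.Graph_Theory"
    "Jordan_Normal_Form.Char_Poly"
    "Jordan_Normal_Form.Gauss_Jordan_Elimination"
    "HOL-Computational_Algebra.Polynomial_Factorial"
begin

text \<open>
  Finite simple undirected graphs are the symmetric, loop-free, finite digraphs
  \<^locale>\<open>pair_graph\<close>: an edge \<open>uv\<close> is the pair of arcs \<open>(u,v)\<close>, \<open>(v,u)\<close>, so the
  degree of a vertex is its out-degree. The null graph is allowed.
\<close>

section \<open>The matrix \<open>A\<^sub>\<alpha>\<close>, its spectrum and its coronal\<close>

text \<open>
  Matrices need an ordering of the vertices. We fix an arbitrary one; another choice
  conjugates the matrices by a permutation matrix, which changes neither the spectrum
  nor the coronal.
\<close>

definition vertex_list :: "'a pair_pre_digraph \<Rightarrow> 'a list" where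
  "vertex_list G = (SOME vs. distinct vs \<and> set vs = pverts G)"

definition adjacency_mat :: "'a pair_pre_digraph \<Rightarrow> real mat" where
  "adjacency_mat G = (let vs = vertex_list G; n = card (pverts G) in
     mat n n (\<lambda>(i, j). if (vs ! i, vs ! j) \<in> parcs G then 1 else 0))"

definition degree_mat :: "'a pair_pre_digraph \<Rightarrow> real mat" where
  "degree_mat G = (let vs = vertex_list G; n = card (pverts G) in
     mat n n (\<lambda>(i, j). if i = j then real (out_degree (with_proj G) (vs ! i)) else 0))"

definition A_alpha :: "real \<Rightarrow> 'a pair_pre_digraph \<Rightarrow> real mat" where
  "A_alpha \<alpha> G = \<alpha> \<cdot>\<^sub>m degree_mat G + (1 - \<alpha>) \<cdot>\<^sub>m adjacency_mat G"

definition A_alpha_spectrum :: "real \<Rightarrow> 'a pair_pre_digraph \<Rightarrow> complex multiset" where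
  "A_alpha_spectrum \<alpha> G = proots (char_poly (map_mat complex_of_real (A_alpha \<alpha> G)))"

text \<open>Cospectral graphs are non-isomorphic by definition.\<close>

definition A_alpha_cospectral ::
    "real \<Rightarrow> 'a pair_pre_digraph \<Rightarrow> 'b pair_pre_digraph \<Rightarrow> bool" where
  "A_alpha_cospectral \<alpha> G\<^sub>1 G\<^sub>2 \<longleftrightarrow>
     \<not> digraph_iso (with_proj G\<^sub>1) (with_proj G\<^sub>2) \<and>
     A_alpha_spectrum \<alpha> G\<^sub>1 = A_alpha_spectrum \<alpha> G\<^sub>2"

text \<open>
  The coronal is an element of the field \<open>\<real>(\<lambda>)\<close> of rational functions, here the type
  \<^typ>\<open>real poly fract\<close>, in which the polynomial \<open>[:- \<alpha>, 1:]\<close> is \<open>\<lambda> - \<alpha>\<close>. Over this field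
  the matrix to be inverted is always invertible, see \<open>coronal_mat_inverse\<close> below.
\<close>

definition coronal_mat :: "real \<Rightarrow> 'a pair_pre_digraph \<Rightarrow> real poly fract mat" where
  "coronal_mat \<alpha> H =
     to_fract [:- \<alpha>, 1:] \<cdot>\<^sub>m 1\<^sub>m (card (pverts H)) - map_mat (\<lambda>x. to_fract [:x:]) (A_alpha \<alpha> H)"

definition A_alpha_coronal :: "real \<Rightarrow> 'a pair_pre_digraph \<Rightarrow> real poly fract" where
  "A_alpha_coronal \<alpha> H = (let t = card (pverts H); ones = vec t (\<lambda>_. 1) in
     ones \<bullet> (the (mat_inverse (coronal_mat \<alpha> H)) *\<^sub>v ones))"

lemma A_alpha_carrier [simp]:
  "A_alpha \<alpha> G \<in> carrier_mat (card (pverts G)) (card (pverts G))"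
  by (simp add: A_alpha_def degree_mat_def adjacency_mat_def Let_def)

lemma coronal_mat_inverse:
  "\<exists>B. mat_inverse (coronal_mat \<alpha> H) = Some B \<and>
       B \<in> carrier_mat (card (pverts H)) (card (pverts H)) \<and>
       coronal_mat \<alpha> H * B = 1\<^sub>m (card (pverts H)) \<and>
       B * coronal_mat \<alpha> H = 1\<^sub>m (card (pverts H))"
proof -
  define t where "t = card (pverts H)"
  define M where "M = A_alpha \<alpha> H + \<alpha> \<cdot>\<^sub>m 1\<^sub>m t"
  have A: "A_alpha \<alpha> H \<in> carrier_mat t t" by (simp add: t_def)
  then have M: "M \<in> carrier_mat t t" by (simp add: M_def)
  interpret h: inj_comm_ring_hom "to_fract :: real poly \<Rightarrow> real poly fract"
    by unfold_locales auto
  have eq: "coronal_mat \<alpha> H = map_mat to_fract (char_poly_matrix M)"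
    using A by (intro eq_matI) (auto simp: coronal_mat_def char_poly_matrix_def M_def one_pCons
        simp flip: t_def h.hom_minus h.hom_uminus)
  have c: "coronal_mat \<alpha> H \<in> carrier_mat t t"
    by (simp add: coronal_mat_def t_def minus_carrier_mat)
  have "det (coronal_mat \<alpha> H) = to_fract (char_poly M)"
    by (simp add: eq char_poly_def h.hom_det)
  moreover have "char_poly M \<noteq> 0"
    using degree_monic_char_poly[OF M] by auto
  ultimately have "det (coronal_mat \<alpha> H) \<noteq> 0" by simp
  then have "coronal_mat \<alpha> H \<in> Units (ring_mat TYPE(real poly fract) t ())"
    by (rule det_non_zero_imp_unit[OF c])
  then show ?thesis
    using mat_inverse(1)[OF c, where b = "()"] mat_inverse(2)[OF c] unfolding t_def by (cases "mat_inverse (coronal_mat \<alpha> H)") auto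
qed

section \<open>The generalized corona\<close>

text \<open>
  The function \<open>g\<close> enumerates the vertices of \<open>G\<close> by \<open>1, \<dots>, n\<close>. The disjoint copies are
  tagged: \<open>Inl u\<close> is a vertex of \<open>G\<close> and \<open>Inr (i, x)\<close> the vertex \<open>x\<close> of the copy of \<open>H i\<close>.
\<close>

definition generalized_corona ::
    "'a pair_pre_digraph \<Rightarrow> (nat \<Rightarrow> 'a) \<Rightarrow> (nat \<Rightarrow> 'b pair_pre_digraph)
      \<Rightarrow> ('a + nat \<times> 'b) pair_pre_digraph" where
  "generalized_corona G g H = (let n = card (pverts G) in
     \<lparr> pverts = {Inl u | u. u \<in> pverts G} \<union> {Inr (i, x) | i x. i \<in> {1..n} \<and> x \<in> pverts (H i)},
       parcs = {(Inl u, Inl v) | u v. (u, v) \<in> parcs G}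
         \<union> {(Inr (i, x), Inr (i, y)) | i x y. i \<in> {1..n} \<and> (x, y) \<in> parcs (H i)}
         \<union> {(Inl (g i), Inr (i, x)) | i x. i \<in> {1..n} \<and> x \<in> pverts (H i)}
         \<union> {(Inr (i, x), Inl (g i)) | i x. i \<in> {1..n} \<and> x \<in> pverts (H i)} \<rparr>)"

lemma pair_graph_generalized_corona:
  assumes G: "pair_graph G" and g: "bij_betw g {1..card (pverts G)} (pverts G)"
    and H: "\<And>i. i \<in> {1..card (pverts G)} \<Longrightarrow> pair_graph (H i)"
  shows "pair_graph (generalized_corona G g H)"
proof -
  define n where "n = card (pverts G)"
  define C where "C = generalized_corona G g H"
  interpret G: pair_graph G by (rule G)
  have gi: "g i \<in> pverts G" if "i \<in> {1..n}" for i
    using that g unfolding bij_betw_def n_def by blast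
  have H': "pair_graph (H i)" if "i \<in> {1..n}" for i
    using H that by (simp add: n_def)
  have wfH: "x \<in> pverts (H i) \<and> y \<in> pverts (H i) \<and> x \<noteq> y \<and> (y, x) \<in> parcs (H i)"
    if "i \<in> {1..n}" "(x, y) \<in> parcs (H i)" for i x y
  proof -
    interpret Hi: pair_graph "H i" using H' that by blast
    show ?thesis
      using that(2) Hi.wellformed' Hi.no_loops' Hi.arcs_symmetric by blast
  qed
  have finH: "finite (pverts (H i))" if "i \<in> {1..n}" for i
  proof -
    interpret Hi: pair_graph "H i" using H' that by blast
    show ?thesis by simp
  qed
  have pv: "pverts C = {Inl u | u. u \<in> pverts G} \<union>
      {Inr (i, x) | i x. i \<in> {1..n} \<and> x \<in> pverts (H i)}"
    by (simp add: C_def generalized_corona_def n_def Let_def)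
  have pa: "parcs C = {(Inl u, Inl v) | u v. (u, v) \<in> parcs G}
         \<union> {(Inr (i, x), Inr (i, y)) | i x y. i \<in> {1..n} \<and> (x, y) \<in> parcs (H i)}
         \<union> {(Inl (g i), Inr (i, x)) | i x. i \<in> {1..n} \<and> x \<in> pverts (H i)}
         \<union> {(Inr (i, x), Inl (g i)) | i x. i \<in> {1..n} \<and> x \<in> pverts (H i)}"
    by (simp add: C_def generalized_corona_def n_def Let_def)
  have sub: "parcs C \<subseteq> pverts C \<times> pverts C"
    using G.wellformed' gi wfH unfolding pv pa by blast
  have "pverts C = Inl ` pverts G \<union> Inr ` (SIGMA i:{1..n}. pverts (H i))"
    unfolding pv by blast
  moreover have "finite (SIGMA i:{1..n}. pverts (H i))"
    using finH by (intro finite_SigmaI) auto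
  ultimately have fin: "finite (pverts C)" by simp
  have "symmetric (with_proj C)"
    unfolding symmetric_def with_proj_simps
    by (rule symI) (use G.arcs_symmetric wfH in \<open>unfold pa, blast\<close>)
  moreover have "fst e \<noteq> snd e" if "e \<in> parcs C" for e
    using that G.no_loops' wfH unfolding pa by auto
  moreover have "finite (parcs C)"
    using finite_subset[OF sub] fin by simp
  ultimately have "pair_graph C"
    using sub fin by unfold_locales auto
  then show ?thesis by (simp add: C_def)
qed

end

theory Submission
  imports Defs
begin

text \<open>
  Cospectrality has two halves, equality of the spectra and non-isomorphism, and the two are
  proved by unrelated arguments.

  For the spectra, work over the field \<open>\<real>(\<lambda>)\<close>. List the vertices of the corona with those of \<open>G\<close>
  first and then the copies of \<open>H\<^sub>1, \<dots>, H\<^sub>n\<close>. In \<open>\<lambda> - A\<^sub>\<alpha>\<close> the copies form a block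
  diagonal matrix \<open>D\<close>, whose blocks are the matrices inverted in the definition of the coronal, and
  each block is joined to its vertex of \<open>G\<close> by a constant vector with entries \<open>- (1 - \<alpha>)\<close>.
  Eliminating \<open>D\<close> subtracts from the block of \<open>G\<close> the diagonal matrix with entries
  \<open>(1 - \<alpha>)\<^sup>2 \<chi>\<^sub>i\<close>, where \<open>\<chi>\<^sub>i\<close> is the coronal of \<open>H\<^sub>i\<close>. As all coronals equal one \<open>\<chi>\<close>,
  this is a scalar matrix, and the characteristic polynomial of the corona is \<open>det D\<close> times that
  of \<open>G\<close> evaluated at \<open>\<lambda> - \<alpha> q - (1 - \<alpha>)\<^sup>2 \<chi>\<close>
  (\<open>to_fract_char_poly_generalized_corona\<close>). Here \<open>G\<close> enters only through its characteristic
  polynomial, which is equivalent to its spectrum (\<open>A_alpha_spectrum_eq_iff\<close>).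

  For non-isomorphism, \<open>G\<close> has to be recovered from the corona up to isomorphism. A vertex of the
  corona is called a pendant hub if \<open>q\<close> of its neighbours form a set that can be left only through
  it, while it has a further neighbour. The pendant hubs are exactly the
  non-isolated vertices of \<open>G\<close> (\<open>pendant_hub_C_iff\<close>). An isomorphism of coronas thus maps the
  non-isolated parts of \<open>G\<^sub>1\<close> and \<open>G\<^sub>2\<close> onto each other, and the numbers of isolated vertices
  agree because the orders do (\<open>digraph_iso_of_generalized_coronas\<close>).
\<close>

section \<open>Determinants and characteristic polynomials\<close>

text \<open>
  Passing from one enumeration to the other applies the same permutation to the rows and to
  the columns, so its sign enters twice.
\<close>
lemma det_reindex:
  fixes f :: "'v \<Rightarrow> 'v \<Rightarrow> 'r :: comm_ring_1"
  assumes "bij_betw e {0..<N} V" and "bij_betw e' {0..<N} V"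
  shows "det (mat N N (\<lambda>(i, j). f (e i) (e j))) = det (mat N N (\<lambda>(i, j). f (e' i) (e' j)))"
proof -
  define p where "p i = (if i < N then the_inv_into {0..<N} e (e' i) else i)" for i
  have "bij_betw (the_inv_into {0..<N} e \<circ> e') {0..<N} {0..<N}"
    using assms bij_betw_the_inv_into bij_betw_trans by blast
  then have "bij_betw p {0..<N} {0..<N}"
    by (subst bij_betw_cong[where g = "the_inv_into {0..<N} e \<circ> e'"]) (auto simp: p_def)
  then have p: "p permutes {0..<N}"
    by (rule bij_imp_permutes) (auto simp: p_def)
  have ep: "e (p i) = e' i" if "i < N" for i
    using that f_the_inv_into_f_bij_betw[OF assms(1)] bij_betwE[OF assms(2)]
    by (simp add: p_def)
  have pN: "p i < N" if "i < N" for i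
    using permutes_in_image[OF p, of i] that by auto
  define A where "A = mat N N (\<lambda>(i, j). f (e i) (e j))"
  define R where "R = mat N N (\<lambda>(i, j). A $$ (p i, j))"
  have A: "A \<in> carrier_mat N N" and R: "R \<in> carrier_mat N N"
    by (auto simp: A_def R_def)
  have "mat N N (\<lambda>(i, j). f (e' i) (e' j))
      = transpose_mat (mat N N (\<lambda>(i, j). transpose_mat R $$ (p i, j)))"
    by (rule eq_matI) (auto simp: R_def A_def ep pN)
  also have "det \<dots> = det (mat N N (\<lambda>(i, j). transpose_mat R $$ (p i, j)))"
    by (rule det_transpose[of _ N]) simp
  also have "\<dots> = signof p * det (transpose_mat R)"
    using R by (intro det_permute_rows p) simp
  also have "det (transpose_mat R) = det R"
    by (rule det_transpose[OF R])
  also have "det R = signof p * det A"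
    unfolding R_def by (rule det_permute_rows[OF A p])
  finally show ?thesis
    by (cases p rule: sign_cases) (simp_all add: A_def)
qed

lemma char_poly_reindex:
  fixes f :: "'v \<Rightarrow> 'v \<Rightarrow> 'r :: comm_ring_1"
  assumes "bij_betw e {0..<N} V" and "bij_betw e' {0..<N} V"
  shows "char_poly (mat N N (\<lambda>(i, j). f (e i) (e j)))
    = char_poly (mat N N (\<lambda>(i, j). f (e' i) (e' j)))"
proof -
  \<comment> \<open>\<open>d\<close> is injective, so the diagonal can be read off from the vertices instead of the indices\<close>
  have *: "char_poly_matrix (mat N N (\<lambda>(i, j). f (d i) (d j)))
      = mat N N (\<lambda>(i, j). (\<lambda>u v. (if u = v then [:0, 1:] else 0) + [:- f u v:]) (d i) (d j))"
    if "bij_betw d {0..<N} V" for d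
    by (rule eq_matI)
      (use bij_betw_imp_inj_on[OF that] in \<open>auto simp: char_poly_matrix_def dest: inj_onD\<close>)
  show ?thesis
    unfolding char_poly_def *[OF assms(1)] *[OF assms(2)] by (rule det_reindex[OF assms])
qed

lemma poly_char_poly:
  assumes "A \<in> carrier_mat n n"
  shows "poly (char_poly A) y = det (y \<cdot>\<^sub>m 1\<^sub>m n - A)"
  unfolding char_poly_def
  by (rule poly_det_cong[of _ n]) (use assms in \<open>auto simp: char_poly_matrix_def minus_carrier_mat\<close>)

text \<open>
  Block elimination: subtracting the last block column times \<open>X\<close> from the first one clears the
  lower left block. Writing that block as \<open>D * X\<close>, instead of inverting \<open>D\<close>, is what makes the
  identity valid over any integral domain.
\<close>
lemma det_four_block_mat_Schur:
  fixes A :: "'r :: idom mat"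
  assumes A: "A \<in> carrier_mat n n" and B: "B \<in> carrier_mat n m"
    and X: "X \<in> carrier_mat m n" and D: "D \<in> carrier_mat m m"
  shows "det (four_block_mat A B (D * X) D) = det (A - B * X) * det D"
proof -
  define U where "U = four_block_mat (1\<^sub>m n) (0\<^sub>m n m) (- X) (1\<^sub>m m)"
  have U: "U \<in> carrier_mat (n + m) (n + m)"
    using X by (simp add: U_def)
  have M: "four_block_mat A B (D * X) D \<in> carrier_mat (n + m) (n + m)"
    using A D by simp
  have "det U = 1"
    unfolding U_def using X by (subst det_four_block_mat_upper_right_zero[of _ n _ m]) auto
  have DX: "D * X \<in> carrier_mat m n" and BX: "B * X \<in> carrier_mat n n"
    using B D X by auto
  have "A * 1\<^sub>m n + B * (- X) = A - B * X" and "A * 0\<^sub>m n m + B * 1\<^sub>m m = B"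
    and "D * X * 1\<^sub>m n + D * (- X) = 0\<^sub>m m n" and "D * X * 0\<^sub>m n m + D * 1\<^sub>m m = D"
    using A B D X DX BX by (auto simp: minus_carrier_mat intro!: eq_matI)
  then have "four_block_mat A B (D * X) D * U = four_block_mat (A - B * X) B (0\<^sub>m m n) D"
    unfolding U_def using X by (subst mult_four_block_mat[OF A B DX D, of _ n _ m]) auto
  then have "det (four_block_mat A B (D * X) D) * det U = det (A - B * X) * det D"
    using det_mult[OF M U] A B D X
    by (simp add: det_four_block_mat_lower_left_zero[of _ n _ m] minus_carrier_mat)
  with \<open>det U = 1\<close> show ?thesis by simp
qed

lemma sum_div_eq_block:
  fixes f :: "nat \<Rightarrow> 'r :: comm_monoid_add"
  assumes "i < n"
  shows "(\<Sum>l = 0..<n * q. if l div q = i then f (l mod q) else 0) = (\<Sum>r = 0..<q. f r)"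
proof -
  have "(\<Sum>l = 0..<n * q. if l div q = i then f (l mod q) else 0)
      = (\<Sum>l\<in>{l\<in>{0..<n * q}. l div q = i}. f (l mod q))"
    by (rule sum.inter_filter[symmetric]) simp
  also have "\<dots> = (\<Sum>r = 0..<q. f r)"
  proof (rule sum.reindex_bij_witness[where i = "\<lambda>r. i * q + r" and j = "\<lambda>l. l mod q"])
    fix r assume r: "r \<in> {0..<q}"
    have "i * q + r < (i + 1) * q" using r by simp
    also have "\<dots> \<le> n * q" using assms by (intro mult_right_mono) auto
    finally show "i * q + r \<in> {l\<in>{0..<n * q}. l div q = i}" using r by auto
  qed (use assms in \<open>auto intro!: mod_less_divisor gr0I\<close>)
  finally show ?thesis .
qed

text \<open>
  All blocks have size \<open>q\<close>, so that \<open>k div q\<close> is the block in which the index \<open>k\<close> lies and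
  \<open>k mod q\<close> its position there.
\<close>
definition block_diag_mat :: "nat \<Rightarrow> nat \<Rightarrow> (nat \<Rightarrow> 'r mat) \<Rightarrow> 'r :: zero mat" where
  "block_diag_mat n q M = mat (n * q) (n * q)
     (\<lambda>(k, l). if k div q = l div q then M (k div q) $$ (k mod q, l mod q) else 0)"

text \<open>
  This is the Kronecker product of the identity with an all-ones column: column \<open>i\<close> is the
  indicator of the \<open>i\<close>th block.
\<close>
definition block_ones_mat :: "nat \<Rightarrow> nat \<Rightarrow> 'r :: zero_neq_one mat" where
  "block_ones_mat n q = mat (n * q) n (\<lambda>(k, i). if k div q = i then 1 else 0)"

text \<open>
  For invertible \<open>M\<^sub>i\<close>, the value \<open>c\<close> is \<open>1\<^sup>T M\<^sub>i\<^sup>-\<^sup>1 1\<close>. Distinct blocks do not interact, so the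
  Schur correction to \<open>A\<close> is a diagonal matrix, and it is scalar precisely because \<open>c\<close> does not
  depend on \<open>i\<close>. This is where the equality of the coronals enters.
\<close>
lemma det_block_diag_bordered:
  fixes A :: "'r :: idom mat"
  assumes A: "A \<in> carrier_mat n n"
    and M: "\<And>i. i < n \<Longrightarrow> M i \<in> carrier_mat q q"
    and x: "\<And>i. i < n \<Longrightarrow> x i \<in> carrier_vec q"
    and Mx: "\<And>i. i < n \<Longrightarrow> M i *\<^sub>v x i = vec q (\<lambda>_. 1)"
    and c: "\<And>i. i < n \<Longrightarrow> vec q (\<lambda>_. 1) \<bullet> x i = c"
  shows "det (four_block_mat A (b \<cdot>\<^sub>m transpose_mat (block_ones_mat n q)) (b \<cdot>\<^sub>m block_ones_mat n q)
       (block_diag_mat n q M)) = det (A - (b\<^sup>2 * c) \<cdot>\<^sub>m 1\<^sub>m n) * det (block_diag_mat n q M)"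
proof -
  let ?E = "block_ones_mat n q :: 'r mat"
  let ?D = "block_diag_mat n q M"
  \<comment> \<open>\<open>b\<close> times the block diagonal matrix with the columns \<open>x\<^sub>i\<close>; it solves \<open>D X = b E\<close>\<close>
  define X where "X = mat (n * q) n (\<lambda>(k, i). if k div q = i then b * x i $ (k mod q) else 0)"
  have divn: "k div q < n" and modq: "k mod q < q" if "k < n * q" for k
    using that by (auto simp: less_mult_imp_div_less intro!: mod_less_divisor gr0I)
  have Mx': "(\<Sum>r = 0..<q. M i $$ (s, r) * x i $ r) = 1" if "i < n" "s < q" for i s
  proof -
    have "(\<Sum>r = 0..<q. M i $$ (s, r) * x i $ r) = (M i *\<^sub>v x i) $ s"
      using M[OF that(1)] x[OF that(1)] that(2) by (auto simp: scalar_prod_def intro!: sum.cong)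
    then show ?thesis using Mx that by simp
  qed
  have DX: "?D * X = b \<cdot>\<^sub>m ?E"
  proof (rule eq_matI)
    fix k i assume "k < dim_row (b \<cdot>\<^sub>m ?E)" "i < dim_col (b \<cdot>\<^sub>m ?E)"
    then have k: "k < n * q" and i: "i < n" by (auto simp: block_ones_mat_def)
    have "(?D * X) $$ (k, i) = (\<Sum>l = 0..<n * q. ?D $$ (k, l) * X $$ (l, i))"
      using k i by (simp add: scalar_prod_def block_diag_mat_def X_def)
    also have "\<dots> = (\<Sum>l = 0..<n * q. if l div q = i
        then (if k div q = i then M i $$ (k mod q, l mod q) * (b * x i $ (l mod q)) else 0) else 0)"
      using k i by (intro sum.cong) (auto simp: block_diag_mat_def X_def)
    also have "\<dots> = (\<Sum>r = 0..<q. if k div q = i then M i $$ (k mod q, r) * (b * x i $ r) else 0)"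
      by (rule sum_div_eq_block[OF i])
    also have "\<dots> = (if k div q = i then b else 0)"
      using Mx'[OF i modq[OF k]] by (simp add: mult.left_commute flip: sum_distrib_left)
    finally show "(?D * X) $$ (k, i) = (b \<cdot>\<^sub>m ?E) $$ (k, i)"
      using k i by (simp add: block_ones_mat_def)
  qed (auto simp: block_diag_mat_def block_ones_mat_def X_def)
  have EX: "(b \<cdot>\<^sub>m transpose_mat ?E) * X = (b\<^sup>2 * c) \<cdot>\<^sub>m 1\<^sub>m n"
  proof (rule eq_matI)
    fix i j assume "i < dim_row ((b\<^sup>2 * c) \<cdot>\<^sub>m 1\<^sub>m n)" "j < dim_col ((b\<^sup>2 * c) \<cdot>\<^sub>m 1\<^sub>m n :: 'r mat)"
    then have i: "i < n" and j: "j < n" by auto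
    have "((b \<cdot>\<^sub>m transpose_mat ?E) * X) $$ (i, j)
        = (\<Sum>l = 0..<n * q. (b \<cdot>\<^sub>m transpose_mat ?E) $$ (i, l) * X $$ (l, j))"
      using i j by (simp add: scalar_prod_def block_ones_mat_def X_def)
    also have "\<dots> = (\<Sum>l = 0..<n * q. if l div q = i
        then (if i = j then b * (b * x i $ (l mod q)) else 0) else 0)"
      using i j by (intro sum.cong) (auto simp: block_ones_mat_def X_def)
    also have "\<dots> = (\<Sum>r = 0..<q. if i = j then b * (b * x i $ r) else 0)"
      by (rule sum_div_eq_block[OF i])
    also have "\<dots> = (if i = j then b\<^sup>2 * c else 0)"
      using c[OF i] x[OF i] by (auto simp: power2_eq_square scalar_prod_def mult.assoc simp flip: sum_distrib_left)
    finally show "((b \<cdot>\<^sub>m transpose_mat ?E) * X) $$ (i, j) = ((b\<^sup>2 * c) \<cdot>\<^sub>m 1\<^sub>m n) $$ (i, j)"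
      using i j by simp
  qed (auto simp: block_ones_mat_def X_def)
  show ?thesis
    using det_four_block_mat_Schur[OF A, of "b \<cdot>\<^sub>m transpose_mat ?E" "n * q" X ?D]
    unfolding DX EX by (simp add: block_ones_mat_def block_diag_mat_def X_def)
qed

lemma complex_poly_eq_iff_proots:
  fixes p q :: "complex poly"
  assumes "lead_coeff p = lead_coeff q"
  shows "p = q \<longleftrightarrow> proots p = proots q"
  using assms complex_poly_decompose_multiset[of p] complex_poly_decompose_multiset[of q] by metis

section \<open>Isomorphism of generalized coronas\<close>

lemma digraph_iso_with_proj_iff:
  assumes "pair_graph G" and "pair_graph H"
  shows "digraph_iso (with_proj G) (with_proj H) \<longleftrightarrow>
    (\<exists>f. bij_betw f (pverts G) (pverts H) \<and>
      (\<forall>u\<in>pverts G. \<forall>v\<in>pverts G. (u, v) \<in> parcs G \<longleftrightarrow> (f u, f v) \<in> parcs H))"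
proof
  interpret G: pair_graph G by fact
  interpret H: pair_graph H by fact
  assume "digraph_iso (with_proj G) (with_proj H)"
  then obtain hom where hom: "pre_digraph.digraph_isomorphism (with_proj G) hom"
    and H: "with_proj H = app_iso hom (with_proj G)"
    unfolding digraph_iso_def by blast
  let ?f = "iso_verts hom" and ?F = "iso_arcs hom"
  have verts: "pverts H = ?f ` pverts G" and arcs: "parcs H = ?F ` parcs G"
    and th: "iso_tail hom = fst" "iso_head hom = snd"
    using H by (metis with_proj_simps app_iso_simps)+
  have inj: "inj_on ?f (pverts G)"
    using hom by (simp add: pre_digraph.digraph_isomorphism_def)
  have F: "?F a = (?f (fst a), ?f (snd a))" if "a \<in> parcs G" for a
    using hom that th by (simp add: pre_digraph.digraph_isomorphism_def prod_eq_iff)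
  have "(u, v) \<in> parcs G \<longleftrightarrow> (?f u, ?f v) \<in> parcs H"
    if "u \<in> pverts G" "v \<in> pverts G" for u v
  proof
    assume "(u, v) \<in> parcs G"
    then show "(?f u, ?f v) \<in> parcs H" using F[of "(u, v)"] arcs by (auto intro: rev_image_eqI)
  next
    assume "(?f u, ?f v) \<in> parcs H"
    then obtain a where a: "a \<in> parcs G" "(?f u, ?f v) = ?F a" using arcs by auto
    with F[OF a(1)] inj that G.wellformed'[of "fst a" "snd a"] have "fst a = u" "snd a = v"
      by (auto dest: inj_onD)
    with a(1) show "(u, v) \<in> parcs G" by auto
  qed
  with inj verts show "\<exists>f. bij_betw f (pverts G) (pverts H) \<and>
      (\<forall>u\<in>pverts G. \<forall>v\<in>pverts G. (u, v) \<in> parcs G \<longleftrightarrow> (f u, f v) \<in> parcs H)"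
    by (auto simp: bij_betw_def)
next
  interpret G: pair_graph G by fact
  interpret H: pair_graph H by fact
  assume "\<exists>f. bij_betw f (pverts G) (pverts H) \<and>
      (\<forall>u\<in>pverts G. \<forall>v\<in>pverts G. (u, v) \<in> parcs G \<longleftrightarrow> (f u, f v) \<in> parcs H)"
  then obtain f where f: "bij_betw f (pverts G) (pverts H)"
    and arc: "\<And>u v. u \<in> pverts G \<Longrightarrow> v \<in> pverts G \<Longrightarrow> (u, v) \<in> parcs G \<longleftrightarrow> (f u, f v) \<in> parcs H"
    by blast
  let ?hom = "\<lparr>iso_verts = f, iso_arcs = map_prod f f, iso_head = snd, iso_tail = fst\<rparr>"
  have inj: "inj_on f (pverts G)" and im: "f ` pverts G = pverts H"
    using f by (auto simp: bij_betw_def)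
  have sub: "parcs G \<subseteq> pverts G \<times> pverts G"
    using G.wellformed' by auto
  have "pre_digraph.digraph_isomorphism (with_proj G) ?hom"
    using inj inj_on_subset[OF map_prod_inj_on[OF inj inj] sub] G.wf_digraph
    by (simp add: pre_digraph.digraph_isomorphism_def)
  moreover have "map_prod f f ` parcs G = parcs H"
  proof
    show "map_prod f f ` parcs G \<subseteq> parcs H" using arc sub by auto
    show "parcs H \<subseteq> map_prod f f ` parcs G"
    proof (rule subrelI)
      fix x y assume xy: "(x, y) \<in> parcs H"
      then obtain u v where "u \<in> pverts G" "v \<in> pverts G" "x = f u" "y = f v"
        using H.wellformed' im by blast
      with xy arc show "(x, y) \<in> map_prod f f ` parcs G" by force
    qed
  qed
  then have "with_proj H = app_iso ?hom (with_proj G)"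
    using im by (simp add: app_iso_def with_proj_def)
  ultimately show "digraph_iso (with_proj G) (with_proj H)"
    unfolding digraph_iso_def by blast
qed

text \<open>
  The set \<open>S\<close> stands for a copy of some \<open>H\<^sub>i\<close>, whose only exit is \<open>v\<close>. The last
  condition, that \<open>v\<close> has a neighbour outside \<open>S\<close>, excludes the vertices that are isolated
  in \<open>G\<close>. Such a vertex cannot in general be told from the vertices of its copy of \<open>H\<^sub>i\<close>:
  if \<open>H\<^sub>i\<close> is complete, the two together form a complete component.
\<close>
definition pendant_hub :: "nat \<Rightarrow> 'a pair_pre_digraph \<Rightarrow> 'a \<Rightarrow> bool" where
  "pendant_hub q G v \<longleftrightarrow> (\<exists>S \<subseteq> pverts G. finite S \<and> card S = q \<and> v \<notin> S \<and>
     (\<forall>x\<in>S. (v, x) \<in> parcs G \<and> (\<forall>y. (x, y) \<in> parcs G \<longrightarrow> y \<in> insert v S)) \<and>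
     (\<exists>y. (v, y) \<in> parcs G \<and> y \<notin> S))"

lemma pendant_hub_iso:
  assumes "pair_graph G" and "pair_graph H"
    and f: "bij_betw f (pverts G) (pverts H)"
    and arc: "\<forall>u\<in>pverts G. \<forall>v\<in>pverts G. (u, v) \<in> parcs G \<longleftrightarrow> (f u, f v) \<in> parcs H"
    and v: "v \<in> pverts G" and hub: "pendant_hub q G v"
  shows "pendant_hub q H (f v)"
proof -
  interpret G: pair_graph G by fact
  interpret H: pair_graph H by fact
  obtain S y where S: "S \<subseteq> pverts G" "finite S" "card S = q" "v \<notin> S"
    and nb: "\<forall>x\<in>S. (v, x) \<in> parcs G \<and> (\<forall>y. (x, y) \<in> parcs G \<longrightarrow> y \<in> insert v S)"
    and y: "(v, y) \<in> parcs G" "y \<notin> S"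
    using hub by (auto simp: pendant_hub_def)
  have yG: "y \<in> pverts G" using y G.wellformed' by blast
  have inj: "inj_on f (pverts G)" and im: "f ` pverts G = pverts H"
    using f by (auto simp: bij_betw_def)
  have mem: "f x \<in> f ` S \<longleftrightarrow> x \<in> S" if "x \<in> pverts G" for x
    using inj S that by (meson inj_on_image_mem_iff)
  show ?thesis
    unfolding pendant_hub_def
  proof (intro exI[of _ "f ` S"] conjI ballI allI impI)
    show "f ` S \<subseteq> pverts H" using S im by blast
    show "finite (f ` S)" using S by blast
    show "card (f ` S) = q" using S inj by (metis card_image inj_on_subset)
    show "f v \<notin> f ` S" using mem v S by blast
    show "\<exists>z. (f v, z) \<in> parcs H \<and> z \<notin> f ` S" using y yG v arc mem by blast
  next
    fix x assume "x \<in> f ` S"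
    then show "(f v, x) \<in> parcs H" using S nb arc v by blast
  next
    fix x z assume x: "x \<in> f ` S" and xz: "(x, z) \<in> parcs H"
    then obtain x' z' where "x' \<in> S" "x = f x'" "z' \<in> pverts G" "z = f z'"
      using H.wellformed' im by blast
    then show "z \<in> insert (f v) (f ` S)" using S nb arc xz by blast
  qed
qed

locale corona_data =
  fixes G :: "'a pair_pre_digraph" and g :: "nat \<Rightarrow> 'a" and H :: "nat \<Rightarrow> 'b pair_pre_digraph"
    and n q :: nat
  assumes G: "pair_graph G" and card_G: "card (pverts G) = n"
    and g: "bij_betw g {1..n} (pverts G)"
    and H: "\<And>i. i \<in> {1..n} \<Longrightarrow> pair_graph (H i)"
    and card_H: "\<And>i. i \<in> {1..n} \<Longrightarrow> card (pverts (H i)) = q"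
begin

sublocale G: pair_graph G by (rule G)

abbreviation C where "C \<equiv> generalized_corona G g H"

sublocale C: pair_graph C
  by (rule pair_graph_generalized_corona) (use G g H card_G in auto)

lemma g_mem: "i \<in> {1..n} \<Longrightarrow> g i \<in> pverts G"
  using g by (auto simp: bij_betw_def)

lemma g_index: "u \<in> pverts G \<Longrightarrow> \<exists>i\<in>{1..n}. u = g i"
  using bij_betw_imp_surj_on[OF g] by blast

lemma g_eq_iff: "i \<in> {1..n} \<Longrightarrow> j \<in> {1..n} \<Longrightarrow> g i = g j \<longleftrightarrow> i = j"
  using g by (auto simp: bij_betw_def dest: inj_onD)

lemma finite_H: "i \<in> {1..n} \<Longrightarrow> finite (pverts (H i))"
  using H pair_fin_digraph.pair_finite_verts
  by (meson pair_graph_def pair_digraph_def)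

lemma H_arcD: "i \<in> {1..n} \<Longrightarrow> (x, y) \<in> parcs (H i) \<Longrightarrow> x \<in> pverts (H i) \<and> y \<in> pverts (H i)"
  using H by (meson pair_graph_def pair_digraph_def pair_fin_digraph_def pair_wf_digraph.wellformed')

lemma H_no_loop: "i \<in> {1..n} \<Longrightarrow> (x, x) \<notin> parcs (H i)"
  using H pair_loopfree_digraph.no_loops' by (metis pair_graph_def pair_digraph_def)

lemma pverts_C: "pverts C = Inl ` pverts G \<union> Inr ` (SIGMA i:{1..n}. pverts (H i))"
  by (auto simp: generalized_corona_def card_G)

lemma arc_C_iff:
  "(Inl u, Inl v) \<in> parcs C \<longleftrightarrow> (u, v) \<in> parcs G"
  "(Inl u, Inr (i, x)) \<in> parcs C \<longleftrightarrow> i \<in> {1..n} \<and> x \<in> pverts (H i) \<and> u = g i"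
  "(Inr (i, x), Inl u) \<in> parcs C \<longleftrightarrow> i \<in> {1..n} \<and> x \<in> pverts (H i) \<and> u = g i"
  "(Inr (i, x), Inr (j, y)) \<in> parcs C \<longleftrightarrow> i = j \<and> i \<in> {1..n} \<and> (x, y) \<in> parcs (H i)"
  by (auto simp: generalized_corona_def card_G Let_def)

text \<open>
  The only closed pendant set of size \<open>q\<close> at a vertex \<open>g i\<close> that is isolated in \<open>G\<close> is the whole
  neighbourhood, the copy of \<open>H\<^sub>i\<close>. At a vertex \<open>h\<close> of this copy, the other vertices of the copy
  number only \<open>q - 1\<close>, so a pendant set must contain \<open>g i\<close>; being closed, it then contains the
  rest of the copy, and no neighbour of \<open>h\<close> is left outside.
\<close>
lemma pendant_hub_C_iff:
  "pendant_hub q C w \<longleftrightarrow> (\<exists>u v. w = Inl u \<and> (u, v) \<in> parcs G)"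
proof
  assume "\<exists>u v. w = Inl u \<and> (u, v) \<in> parcs G"
  then obtain u v where w: "w = Inl u" and uv: "(u, v) \<in> parcs G" by blast
  then obtain i where i: "i \<in> {1..n}" and u: "u = g i"
    using g_index G.wellformed' by blast
  let ?S = "(\<lambda>x. Inr (i, x)) ` pverts (H i) :: ('a + nat \<times> 'b) set"
  show "pendant_hub q C w"
    unfolding pendant_hub_def
  proof (intro exI[of _ ?S] conjI ballI allI impI)
    show "card ?S = q" using card_H[OF i] by (subst card_image) (auto intro: inj_onI)
    show "\<exists>y. (w, y) \<in> parcs C \<and> y \<notin> ?S" using uv w arc_C_iff(1) by blast
  next
    fix x y assume "x \<in> ?S" "(x, y) \<in> parcs C"
    then show "y \<in> insert w ?S"
      using i u w H_arcD[OF i] by (cases y) (auto simp: arc_C_iff)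
  qed (use i u w finite_H in \<open>auto simp: pverts_C arc_C_iff\<close>)
next
  assume "pendant_hub q C w"
  then obtain S y where S: "S \<subseteq> pverts C" "finite S" "card S = q" "w \<notin> S"
    and nb: "\<And>x. x \<in> S \<Longrightarrow> (w, x) \<in> parcs C"
    and cl: "\<And>x z. x \<in> S \<Longrightarrow> (x, z) \<in> parcs C \<Longrightarrow> z \<in> insert w S"
    and y: "(w, y) \<in> parcs C" "y \<notin> S"
    unfolding pendant_hub_def by blast
  show "\<exists>u v. w = Inl u \<and> (u, v) \<in> parcs G"
  proof (cases w)
    case (Inl u)
    have "\<exists>v. (u, v) \<in> parcs G"
    proof (rule ccontr)
      assume no: "\<nexists>v. (u, v) \<in> parcs G"
      have "u \<in> pverts G" using y(1) Inl C.wellformed' by (fastforce simp: pverts_C)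
      then obtain i where i: "i \<in> {1..n}" "u = g i" using g_index by blast
      let ?B = "(\<lambda>x. Inr (i, x)) ` pverts (H i) :: ('a + nat \<times> 'b) set"
      have nbs: "z \<in> ?B" if "(w, z) \<in> parcs C" for z
        using that no Inl i by (cases z) (auto simp: arc_C_iff g_eq_iff)
      then have "S \<subseteq> ?B" using nb by blast
      moreover have "card ?B = q" using card_H[OF i(1)] by (subst card_image) (auto intro: inj_onI)
      ultimately have "S = ?B"
        using S(3) finite_H[OF i(1)] by (metis card_subset_eq finite_imageI)
      with nbs y show False by blast
    qed
    with Inl show ?thesis by blast
  next
    case (Inr p)
    obtain i h where p: "p = (i, h)" by (cases p)
    have i: "i \<in> {1..n}" and h: "h \<in> pverts (H i)"
      using y(1) C.wellformed' Inr p by (fastforce simp: pverts_C)+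
    let ?B = "(\<lambda>x. Inr (i, x)) ` (pverts (H i) - {h}) :: ('a + nat \<times> 'b) set"
    have card_B: "card ?B = q - 1"
      using card_H[OF i] h by (subst card_image) (auto intro: inj_onI)
    have q: "q > 0" using card_H[OF i] h finite_H[OF i] card_gt_0_iff by blast
    have "b \<in> pverts (H i) - {h}" if "(h, b) \<in> parcs (H i)" for b
      using that H_arcD[OF i] H_no_loop[OF i] by blast
    then have nbs: "z \<in> insert (Inl (g i)) ?B" if "(w, z) \<in> parcs C" for z
      using that Inr p by (cases z) (auto simp: arc_C_iff)
    have "Inl (g i) \<in> S"
    proof (rule ccontr)
      assume "Inl (g i) \<notin> S"
      then have "S \<subseteq> ?B" using nb nbs by blast
      then have "card S \<le> card ?B"
        by (rule card_mono[rotated]) (use finite_H[OF i] in simp)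
      with S(3) card_B q show False by simp
    qed
    have "?B \<subseteq> S"
    proof
      fix z assume "z \<in> ?B"
      then obtain x where "x \<in> pverts (H i)" "x \<noteq> h" "z = Inr (i, x)" by blast
      with cl[OF \<open>Inl (g i) \<in> S\<close>, of z] i Inr p show "z \<in> S" by (simp add: arc_C_iff)
    qed
    with \<open>Inl (g i) \<in> S\<close> nbs y show ?thesis by blast
  qed
qed

end

text \<open>
  Coronas determine their cores. An isomorphism of the coronas preserves pendant hubs, so it
  restricts to an isomorphism between the subgraphs of non-isolated vertices of \<open>G\<^sub>1\<close> and \<open>G\<^sub>2\<close>.
  As both have \<open>n\<close> vertices, they also have equally many isolated vertices, which can be matched
  arbitrarily.
\<close>
proposition digraph_iso_of_generalized_coronas:
  fixes G\<^sub>1 :: "'a pair_pre_digraph" and G\<^sub>2 :: "'b pair_pre_digraph"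
    and H :: "nat \<Rightarrow> 'c pair_pre_digraph" and H' :: "nat \<Rightarrow> 'd pair_pre_digraph"
  assumes c1: "corona_data G\<^sub>1 g\<^sub>1 H n q" and c2: "corona_data G\<^sub>2 g\<^sub>2 H' n q"
    and iso: "digraph_iso (with_proj (generalized_corona G\<^sub>1 g\<^sub>1 H))
      (with_proj (generalized_corona G\<^sub>2 g\<^sub>2 H'))"
  shows "digraph_iso (with_proj G\<^sub>1) (with_proj G\<^sub>2)"
proof -
  interpret A: corona_data G\<^sub>1 g\<^sub>1 H n q by fact
  interpret B: corona_data G\<^sub>2 g\<^sub>2 H' n q by fact
  obtain f where f: "bij_betw f (pverts A.C) (pverts B.C)"
    and arc: "\<forall>u\<in>pverts A.C. \<forall>v\<in>pverts A.C. (u, v) \<in> parcs A.C \<longleftrightarrow> (f u, f v) \<in> parcs B.C"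
    using iso digraph_iso_with_proj_iff[OF A.C.pair_graph B.C.pair_graph] by blast
  define f' where "f' = the_inv_into (pverts A.C) f"
  have f': "bij_betw f' (pverts B.C) (pverts A.C)"
    unfolding f'_def by (rule bij_betw_the_inv_into[OF f])
  have ff': "f (f' w) = w" if "w \<in> pverts B.C" for w
    unfolding f'_def by (rule f_the_inv_into_f_bij_betw[OF f that])
  have arc': "\<forall>u\<in>pverts B.C. \<forall>v\<in>pverts B.C. (u, v) \<in> parcs B.C \<longleftrightarrow> (f' u, f' v) \<in> parcs A.C"
  proof (intro ballI)
    fix u v assume uv: "u \<in> pverts B.C" "v \<in> pverts B.C"
    then have "f' u \<in> pverts A.C" "f' v \<in> pverts A.C" using bij_betwE[OF f'] by blast+
    with arc ff'[OF uv(1)] ff'[OF uv(2)] show "(u, v) \<in> parcs B.C \<longleftrightarrow> (f' u, f' v) \<in> parcs A.C"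
      by simp
  qed
  define N\<^sub>1 where "N\<^sub>1 = {u. \<exists>v. (u, v) \<in> parcs G\<^sub>1}"
  define N\<^sub>2 where "N\<^sub>2 = {u. \<exists>v. (u, v) \<in> parcs G\<^sub>2}"
  have N: "N\<^sub>1 \<subseteq> pverts G\<^sub>1" "N\<^sub>2 \<subseteq> pverts G\<^sub>2"
    using A.G.wellformed' B.G.wellformed' by (auto simp: N\<^sub>1_def N\<^sub>2_def)
  have hub1: "pendant_hub q A.C w \<longleftrightarrow> w \<in> Inl ` N\<^sub>1" for w
    unfolding A.pendant_hub_C_iff N\<^sub>1_def by blast
  have hub2: "pendant_hub q B.C w \<longleftrightarrow> w \<in> Inl ` N\<^sub>2" for w
    unfolding B.pendant_hub_C_iff N\<^sub>2_def by blast
  have sub: "Inl ` N\<^sub>1 \<subseteq> pverts A.C" "Inl ` N\<^sub>2 \<subseteq> pverts B.C"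
    using N by (auto simp: A.pverts_C B.pverts_C)
  have "f ` Inl ` N\<^sub>1 = Inl ` N\<^sub>2"
  proof
    show "f ` Inl ` N\<^sub>1 \<subseteq> Inl ` N\<^sub>2"
    proof
      fix w assume "w \<in> f ` Inl ` N\<^sub>1"
      then obtain z where "z \<in> Inl ` N\<^sub>1" "w = f z" by blast
      then show "w \<in> Inl ` N\<^sub>2"
        using pendant_hub_iso[OF A.C.pair_graph B.C.pair_graph f arc, of z q] hub1 hub2 sub by blast
    qed
    show "Inl ` N\<^sub>2 \<subseteq> f ` Inl ` N\<^sub>1"
    proof
      fix w :: "'b + nat \<times> 'd" assume w: "w \<in> Inl ` N\<^sub>2"
      then have "f' w \<in> Inl ` N\<^sub>1"
        using pendant_hub_iso[OF B.C.pair_graph A.C.pair_graph f' arc', of w q] hub1 hub2 sub by blast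
      then show "w \<in> f ` Inl ` N\<^sub>1" using ff'[of w] w sub by force
    qed
  qed
  moreover have "inj_on f (Inl ` N\<^sub>1)"
    using f sub by (auto simp: bij_betw_def intro: inj_on_subset)
  ultimately have fN: "bij_betw f (Inl ` N\<^sub>1) (Inl ` N\<^sub>2)" by (simp add: bij_betw_def)
  define h where "h u = projl (f (Inl u))" for u
  have fh: "f (Inl u) = Inl (h u)" if "u \<in> N\<^sub>1" for u
    using bij_betwE[OF fN] that by (auto simp: h_def)
  have h: "bij_betw h N\<^sub>1 N\<^sub>2"
  proof (rule bij_betw_imageI)
    show "inj_on h N\<^sub>1"
      using bij_betw_imp_inj_on[OF fN] fh by (metis image_eqI inj_onD inj_onI sum.inject(1))
    have "Inl ` h ` N\<^sub>1 = (Inl ` N\<^sub>2 :: ('b + nat \<times> 'd) set)"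
      using fh bij_betw_imp_surj_on[OF fN] by (metis (no_types, lifting) image_cong image_image)
    then show "h ` N\<^sub>1 = N\<^sub>2" by (simp add: inj_image_eq_iff)
  qed
  have fin: "finite (pverts G\<^sub>1)" "finite (pverts G\<^sub>2)" by simp_all
  have "card (pverts G\<^sub>1 - N\<^sub>1) = card (pverts G\<^sub>2 - N\<^sub>2)"
    using N fin A.card_G B.card_G bij_betw_same_card[OF h]
    by (simp add: card_Diff_subset finite_subset)
  then obtain k where k: "bij_betw k (pverts G\<^sub>1 - N\<^sub>1) (pverts G\<^sub>2 - N\<^sub>2)"
    using finite_same_card_bij[of "pverts G\<^sub>1 - N\<^sub>1" "pverts G\<^sub>2 - N\<^sub>2"] fin by auto
  define m where "m u = (if u \<in> N\<^sub>1 then h u else k u)" for u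
  have "bij_betw m N\<^sub>1 N\<^sub>2"
    using h by (subst bij_betw_cong[where g = h]) (auto simp: m_def)
  moreover have mk: "bij_betw m (pverts G\<^sub>1 - N\<^sub>1) (pverts G\<^sub>2 - N\<^sub>2)"
    using k by (subst bij_betw_cong[where g = k]) (auto simp: m_def)
  ultimately have "bij_betw m (N\<^sub>1 \<union> (pverts G\<^sub>1 - N\<^sub>1)) (N\<^sub>2 \<union> (pverts G\<^sub>2 - N\<^sub>2))"
    by (rule bij_betw_combine) blast
  then have m: "bij_betw m (pverts G\<^sub>1) (pverts G\<^sub>2)"
    using N by (simp add: Un_absorb1)
  have "(u, v) \<in> parcs G\<^sub>1 \<longleftrightarrow> (m u, m v) \<in> parcs G\<^sub>2"
    if uv: "u \<in> pverts G\<^sub>1" "v \<in> pverts G\<^sub>1" for u v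
  proof (cases "u \<in> N\<^sub>1 \<and> v \<in> N\<^sub>1")
    case True
    then have "(u, v) \<in> parcs G\<^sub>1 \<longleftrightarrow> (Inl u, Inl v) \<in> parcs A.C" by (simp add: A.arc_C_iff)
    also have "\<dots> \<longleftrightarrow> (f (Inl u), f (Inl v)) \<in> parcs B.C"
      using arc True sub by blast
    also have "\<dots> \<longleftrightarrow> (m u, m v) \<in> parcs G\<^sub>2"
      using True by (simp add: fh m_def B.arc_C_iff)
    finally show ?thesis .
  next
    case False
    then have "m u \<notin> N\<^sub>2 \<or> m v \<notin> N\<^sub>2" using bij_betwE[OF mk] uv by blast
    then have "(m u, m v) \<notin> parcs G\<^sub>2"
      using B.G.arcs_symmetric by (auto simp: N\<^sub>2_def)
    moreover have "(u, v) \<notin> parcs G\<^sub>1"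
      using False A.G.arcs_symmetric by (auto simp: N\<^sub>1_def)
    ultimately show ?thesis by blast
  qed
  with m show ?thesis
    using digraph_iso_with_proj_iff[OF A.G.pair_graph B.G.pair_graph] by blast
qed

section \<open>The spectrum of a generalized corona\<close>

text \<open>
  The entries of \<open>A\<^sub>\<alpha>\<close> indexed by the vertices themselves, so that one and the same matrix can be
  written down for different enumerations.
\<close>
definition alpha_entry :: "real \<Rightarrow> 'a pair_pre_digraph \<Rightarrow> 'a \<Rightarrow> 'a \<Rightarrow> real" where
  "alpha_entry \<alpha> G u v = (if u = v then \<alpha> * card {w. (u, w) \<in> parcs G} else 0)
     + (if (u, v) \<in> parcs G then 1 - \<alpha> else 0)"

lemma out_degree_with_proj: "out_degree (with_proj G) u = card {w. (u, w) \<in> parcs G}"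
proof -
  have "out_arcs (with_proj G) u = Pair u ` {w. (u, w) \<in> parcs G}"
    by (auto simp: out_arcs_def)
  then show ?thesis
    by (simp add: out_degree_def card_image inj_on_def)
qed

lemma vertex_list:
  assumes "finite (pverts G)"
  shows "distinct (vertex_list G)" and "set (vertex_list G) = pverts G"
proof -
  have "\<exists>vs. distinct vs \<and> set vs = pverts G"
    using finite_distinct_list[OF assms] by blast
  then have "distinct (vertex_list G) \<and> set (vertex_list G) = pverts G"
    unfolding vertex_list_def by (rule someI_ex)
  then show "distinct (vertex_list G)" and "set (vertex_list G) = pverts G"
    by simp_all
qed

lemma length_vertex_list:
  assumes "finite (pverts G)"
  shows "length (vertex_list G) = card (pverts G)"
  using distinct_card[OF vertex_list(1)[OF assms]] vertex_list(2)[OF assms] by simp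

lemma bij_betw_vertex_list:
  assumes "finite (pverts G)"
  shows "bij_betw ((!) (vertex_list G)) {0..<card (pverts G)} (pverts G)"
  by (rule bij_betw_nth)
    (simp_all add: vertex_list[OF assms] length_vertex_list[OF assms] atLeast0LessThan)

lemma A_alpha_eq_mat:
  assumes "finite (pverts G)"
  shows "A_alpha \<alpha> G = mat (card (pverts G)) (card (pverts G))
    (\<lambda>(i, j). alpha_entry \<alpha> G (vertex_list G ! i) (vertex_list G ! j))"
proof (rule eq_matI)
  let ?n = "card (pverts G)" and ?v = "(!) (vertex_list G)"
  fix i j
  assume "i < dim_row (mat ?n ?n (\<lambda>(i, j). alpha_entry \<alpha> G (?v i) (?v j)))"
    and "j < dim_col (mat ?n ?n (\<lambda>(i, j). alpha_entry \<alpha> G (?v i) (?v j)))"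
  then have ij: "i < ?n" "j < ?n" by simp_all
  then have "?v i = ?v j \<longleftrightarrow> i = j"
    using nth_eq_iff_index_eq[OF vertex_list(1)[OF assms]] length_vertex_list[OF assms] by simp
  with ij show "A_alpha \<alpha> G $$ (i, j) = mat ?n ?n (\<lambda>(i, j). alpha_entry \<alpha> G (?v i) (?v j)) $$ (i, j)"
    by (simp add: A_alpha_def degree_mat_def adjacency_mat_def Let_def alpha_entry_def
        out_degree_with_proj)
qed (simp_all add: carrier_matD[OF A_alpha_carrier])

lemma char_poly_A_alpha:
  assumes "finite (pverts G)" and "bij_betw e {0..<card (pverts G)} (pverts G)"
  shows "char_poly (A_alpha \<alpha> G) = char_poly (mat (card (pverts G)) (card (pverts G))
    (\<lambda>(i, j). alpha_entry \<alpha> G (e i) (e j)))"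
  unfolding A_alpha_eq_mat[OF assms(1)]
  by (rule char_poly_reindex[OF bij_betw_vertex_list[OF assms(1)] assms(2)])

lemma char_poly_map_of_real:
  assumes "A \<in> carrier_mat n n"
  shows "char_poly (map_mat complex_of_real A) = map_poly of_real (char_poly A)"
  by (rule of_real_hom.char_poly_hom[OF assms])

text \<open>
  Over \<open>\<complex>\<close> the monic characteristic polynomial is the product of its linear factors, so it can be
  recovered from the spectrum.
\<close>
lemma A_alpha_spectrum_eq_iff:
  "A_alpha_spectrum \<alpha> G = A_alpha_spectrum \<alpha> G' \<longleftrightarrow>
    char_poly (A_alpha \<alpha> G) = char_poly (A_alpha \<alpha> G')"
proof -
  interpret inj_comm_ring_hom "complex_of_real" by unfold_locales auto
  interpret P: map_poly_inj_comm_ring_hom "complex_of_real" ..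
  have monic: "lead_coeff (char_poly (map_mat complex_of_real (A_alpha \<alpha> K))) = 1"
    for K :: "'c pair_pre_digraph"
    using degree_monic_char_poly[of "map_mat complex_of_real (A_alpha \<alpha> K)" "card (pverts K)"] by simp
  have "A_alpha_spectrum \<alpha> G = A_alpha_spectrum \<alpha> G' \<longleftrightarrow>
    char_poly (map_mat complex_of_real (A_alpha \<alpha> G)) = char_poly (map_mat complex_of_real (A_alpha \<alpha> G'))"
    unfolding A_alpha_spectrum_def using complex_poly_eq_iff_proots by (metis monic)
  then show ?thesis
    by (simp add: char_poly_map_of_real[OF A_alpha_carrier])
qed

definition const_fract :: "real \<Rightarrow> real poly fract" where
  "const_fract x = to_fract [:x:]"

lemma const_fract_simps:
  "const_fract 0 = 0" "const_fract 1 = 1" "const_fract (x + y) = const_fract x + const_fract y"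
  "const_fract (x * y) = const_fract x * const_fract y" "const_fract (- x) = - const_fract x"
  by (simp_all add: const_fract_def flip: to_fract_mult to_fract_add to_fract_uminus one_pCons)

interpretation const_fract: comm_ring_hom const_fract
  by unfold_locales (simp_all add: const_fract_simps)

lemma to_fract_char_poly:
  assumes "A \<in> carrier_mat n n"
  shows "to_fract (char_poly A) = det (to_fract [:0, 1:] \<cdot>\<^sub>m 1\<^sub>m n - map_mat const_fract A)"
proof -
  interpret h: inj_comm_ring_hom "to_fract :: real poly \<Rightarrow> real poly fract"
    by unfold_locales auto
  have "map_mat to_fract (char_poly_matrix A) = to_fract [:0, 1:] \<cdot>\<^sub>m 1\<^sub>m n - map_mat const_fract A"
    using assms by (intro eq_matI)
      (auto simp: char_poly_matrix_def const_fract_def simp flip: to_fract_diff to_fract_uminus)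
  then show ?thesis by (simp add: char_poly_def flip: h.hom_det)
qed

lemma coronal_mat_carrier:
  "coronal_mat \<alpha> H \<in> carrier_mat (card (pverts H)) (card (pverts H))"
  by (simp add: coronal_mat_def minus_carrier_mat)

text \<open>
  A solution \<open>x\<close> of \<open>M x = 1\<close> carries all that is needed about the inverse of the coronal matrix \<open>M\<close>.
\<close>
lemma coronal_witness:
  obtains x where "x \<in> carrier_vec (card (pverts H))"
    "coronal_mat \<alpha> H *\<^sub>v x = vec (card (pverts H)) (\<lambda>_. 1)"
    "vec (card (pverts H)) (\<lambda>_. 1) \<bullet> x = A_alpha_coronal \<alpha> H"
proof -
  let ?t = "card (pverts H)"
  let ?o = "vec ?t (\<lambda>_. 1) :: real poly fract vec"
  obtain B where B: "mat_inverse (coronal_mat \<alpha> H) = Some B" "B \<in> carrier_mat ?t ?t"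
    "coronal_mat \<alpha> H * B = 1\<^sub>m ?t"
    using coronal_mat_inverse by blast
  note M = coronal_mat_carrier[of \<alpha> H]
  have "coronal_mat \<alpha> H *\<^sub>v (B *\<^sub>v ?o) = ?o"
    using assoc_mult_mat_vec[OF M B(2), of ?o] B(3) by simp
  moreover have "?o \<bullet> (B *\<^sub>v ?o) = A_alpha_coronal \<alpha> H"
    by (simp add: A_alpha_coronal_def B(1) Let_def)
  ultimately show ?thesis using that[of "B *\<^sub>v ?o"] B(2) by simp
qed

context corona_data
begin

text \<open>
  The vertices of \<open>G\<close> come first, in the order of \<open>g\<close>, and then the copies of \<open>H\<^sub>1, \<dots>, H\<^sub>n\<close>. The shift
  by \<open>Suc\<close> reconciles matrix indices, which start at 0, with \<open>g\<close> and \<open>H\<close>, which start at 1.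
\<close>
definition C_vertex :: "nat \<Rightarrow> 'a + nat \<times> 'b" where
  "C_vertex k = (if k < n then Inl (g (Suc k))
     else let l = k - n; i = Suc (l div q) in Inr (i, vertex_list (H i) ! (l mod q)))"

lemma bij_betw_g_Suc: "bij_betw (\<lambda>k. g (Suc k)) {0..<n} (pverts G)"
proof -
  have "bij_betw Suc {0..<n} {1..n}"
    by (simp add: bij_betw_def image_Suc_atLeastLessThan atLeastLessThanSuc_atLeastAtMost)
  from bij_betw_trans[OF this g] show ?thesis by (simp add: comp_def)
qed

lemma H_vertices: "i \<in> {1..n} \<Longrightarrow> bij_betw ((!) (vertex_list (H i))) {0..<q} (pverts (H i))"
  using bij_betw_vertex_list[OF finite_H] card_H by simp

lemma card_C: "card (pverts C) = n + n * q"
proof -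
  have "card (pverts C) = card (pverts G) + card (SIGMA i:{1..n}. pverts (H i))"
    unfolding pverts_C using finite_H
    by (subst card_Un_disjoint) (auto simp: card_image)
  also have "card (SIGMA i:{1..n}. pverts (H i)) = n * q"
    using card_SigmaI[of "{1..n}" "\<lambda>i. pverts (H i)"] finite_H card_H by simp
  finally show ?thesis by (simp add: card_G)
qed

lemma bij_betw_C_vertex: "bij_betw C_vertex {0..<card (pverts C)} (pverts C)"
proof -
  have "C_vertex ` {0..<n + n * q} = pverts C"
  proof
    show "C_vertex ` {0..<n + n * q} \<subseteq> pverts C"
    proof
      fix w assume "w \<in> C_vertex ` {0..<n + n * q}"
      then obtain k where k: "k < n + n * q" "w = C_vertex k" by auto
      show "w \<in> pverts C"
      proof (cases "k < n")
        case True
        then show ?thesis using k g_mem by (auto simp: C_vertex_def pverts_C)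
      next
        case False
        then have "k - n < n * q" using k by auto
        then have "Suc ((k - n) div q) \<in> {1..n}" and "(k - n) mod q \<in> {0..<q}"
          by (auto simp: less_mult_imp_div_less Suc_le_eq intro!: mod_less_divisor gr0I)
        then show ?thesis
          using False k bij_betwE[OF H_vertices] by (auto simp: C_vertex_def pverts_C Let_def)
      qed
    qed
  next
    show "pverts C \<subseteq> C_vertex ` {0..<n + n * q}"
    proof
      fix w assume "w \<in> pverts C"
      then consider u where "u \<in> pverts G" "w = Inl u"
        | i x where "i \<in> {1..n}" "x \<in> pverts (H i)" "w = Inr (i, x)"
        unfolding pverts_C by blast
      then show "w \<in> C_vertex ` {0..<n + n * q}"
      proof cases
        case 1
        then obtain k where "k < n" "u = g (Suc k)"
          using bij_betw_imp_surj_on[OF bij_betw_g_Suc] by force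
        then show ?thesis using 1 by (intro image_eqI[of _ _ k]) (auto simp: C_vertex_def)
      next
        case 2
        then obtain r where r: "r < q" "x = vertex_list (H i) ! r"
          using bij_betw_imp_surj_on[OF H_vertices[OF 2(1)]] by force
        have "(i - 1) * q + r < (i - 1 + 1) * q" using r(1) by simp
        also have "\<dots> \<le> n * q" using 2(1) by (intro mult_right_mono) auto
        finally show ?thesis using 2 r
          by (intro image_eqI[of _ _ "n + ((i - 1) * q + r)"]) (auto simp: C_vertex_def Let_def)
      qed
    qed
  qed
  moreover from this have "inj_on C_vertex {0..<n + n * q}"
    by (intro eq_card_imp_inj_on) (simp_all add: card_C)
  ultimately show ?thesis by (simp add: bij_betw_def card_C)
qed

text \<open>
  The corona raises the degree of each vertex of \<open>G\<close> by \<open>q\<close> and that of each vertex of \<open>H\<^sub>i\<close> by 1.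
  The latter accounts for the shift by \<open>\<alpha>\<close> in the definition of the coronal.
\<close>
lemma alpha_entry_C:
  "i \<in> {1..n} \<Longrightarrow> alpha_entry \<alpha> C (Inl (g i)) (Inl v)
     = alpha_entry \<alpha> G (g i) v + (if g i = v then \<alpha> * q else 0)"
  "i \<in> {1..n} \<Longrightarrow> j \<in> {1..n} \<Longrightarrow> x \<in> pverts (H j) \<Longrightarrow>
     alpha_entry \<alpha> C (Inl (g i)) (Inr (j, x)) = (if i = j then 1 - \<alpha> else 0)"
  "i \<in> {1..n} \<Longrightarrow> j \<in> {1..n} \<Longrightarrow> x \<in> pverts (H j) \<Longrightarrow>
     alpha_entry \<alpha> C (Inr (j, x)) (Inl (g i)) = (if i = j then 1 - \<alpha> else 0)"
  "i \<in> {1..n} \<Longrightarrow> x \<in> pverts (H i) \<Longrightarrow>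
     alpha_entry \<alpha> C (Inr (i, x)) (Inr (j, y))
       = (if i = j then alpha_entry \<alpha> (H i) x y + (if x = y then \<alpha> else 0) else 0)"
proof -
  have deg_G: "card {w. (Inl (g i), w) \<in> parcs C} = card {w. (g i, w) \<in> parcs G} + q"
    if i: "i \<in> {1..n}" for i
  proof -
    have "(Inl (g i), w) \<in> parcs C
        \<longleftrightarrow> w \<in> Inl ` {w. (g i, w) \<in> parcs G} \<union> (\<lambda>x. Inr (i, x)) ` pverts (H i)" for w
      using i by (cases w) (auto simp: arc_C_iff g_eq_iff)
    then have "{w. (Inl (g i), w) \<in> parcs C}
        = Inl ` {w. (g i, w) \<in> parcs G} \<union> (\<lambda>x. Inr (i, x)) ` pverts (H i)" by blast
    moreover have "finite {w. (g i, w) \<in> parcs G}"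
      by (rule finite_subset[of _ "pverts G"]) (use G.wellformed' in auto)
    ultimately show ?thesis
      using finite_H[OF i] card_H[OF i]
      by (simp, subst card_Un_disjoint) (auto simp: card_image inj_on_def)
  qed
  have deg_H: "card {w. (Inr (i, x), w) \<in> parcs C} = card {w. (x, w) \<in> parcs (H i)} + 1"
    if i: "i \<in> {1..n}" and x: "x \<in> pverts (H i)" for i x
  proof -
    have "(Inr (i, x), w) \<in> parcs C
        \<longleftrightarrow> w \<in> insert (Inl (g i)) ((\<lambda>y. Inr (i, y)) ` {y. (x, y) \<in> parcs (H i)})" for w
      using i x by (cases w) (auto simp: arc_C_iff)
    then have "{w. (Inr (i, x), w) \<in> parcs C}
        = insert (Inl (g i)) ((\<lambda>y. Inr (i, y)) ` {y. (x, y) \<in> parcs (H i)})" by blast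
    moreover have "finite {y. (x, y) \<in> parcs (H i)}"
      by (rule finite_subset[of _ "pverts (H i)"]) (use H_arcD[OF i] finite_H[OF i] in auto)
    ultimately show ?thesis by (simp add: card_image inj_on_def image_iff)
  qed
  show "i \<in> {1..n} \<Longrightarrow> alpha_entry \<alpha> C (Inl (g i)) (Inl v)
     = alpha_entry \<alpha> G (g i) v + (if g i = v then \<alpha> * q else 0)"
    using deg_G[of i] by (auto simp: alpha_entry_def arc_C_iff algebra_simps)
  show "i \<in> {1..n} \<Longrightarrow> j \<in> {1..n} \<Longrightarrow> x \<in> pverts (H j) \<Longrightarrow>
     alpha_entry \<alpha> C (Inl (g i)) (Inr (j, x)) = (if i = j then 1 - \<alpha> else 0)"
    by (simp add: alpha_entry_def arc_C_iff g_eq_iff)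
  show "i \<in> {1..n} \<Longrightarrow> j \<in> {1..n} \<Longrightarrow> x \<in> pverts (H j) \<Longrightarrow>
     alpha_entry \<alpha> C (Inr (j, x)) (Inl (g i)) = (if i = j then 1 - \<alpha> else 0)"
    by (simp add: alpha_entry_def arc_C_iff g_eq_iff)
  show "i \<in> {1..n} \<Longrightarrow> x \<in> pverts (H i) \<Longrightarrow>
     alpha_entry \<alpha> C (Inr (i, x)) (Inr (j, y))
       = (if i = j then alpha_entry \<alpha> (H i) x y + (if x = y then \<alpha> else 0) else 0)"
    using deg_H[of i x] by (auto simp: alpha_entry_def arc_C_iff algebra_simps)
qed

lemma coronal_mat_index:
  assumes i: "i \<in> {1..n}" and "r < q" "s < q"
  shows "coronal_mat \<alpha> (H i) $$ (r, s) = (if r = s then to_fract [:0, 1:] - const_fract \<alpha> else 0)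
    - const_fract (alpha_entry \<alpha> (H i) (vertex_list (H i) ! r) (vertex_list (H i) ! s))"
  using assms A_alpha_eq_mat[OF finite_H[OF i], of \<alpha>] card_H[OF i]
  by (simp add: coronal_mat_def const_fract_def flip: to_fract_diff)

text \<open>
  In the order given by \<open>C_vertex\<close>, the matrix \<open>\<lambda> - A\<^sub>\<alpha>\<close> of the corona is a bordered block diagonal matrix.
  Its diagonal blocks are the coronal matrices of the \<open>H\<^sub>i\<close>, and its upper left block is
  \<open>\<lambda> - \<alpha> q - A\<^sub>\<alpha>(G)\<close>. The Schur complement is therefore \<open>y - A\<^sub>\<alpha>(G)\<close> with the scalar
  \<open>y = \<lambda> - \<alpha> q - (1 - \<alpha>)\<^sup>2 \<chi>\<close>, and its determinant is the characteristic polynomial of \<open>G\<close> at \<open>y\<close>.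
\<close>
proposition to_fract_char_poly_generalized_corona:
  assumes coronal: "\<And>i. i \<in> {1..n} \<Longrightarrow> A_alpha_coronal \<alpha> (H i) = \<chi>"
  shows "to_fract (char_poly (A_alpha \<alpha> C)) =
    poly (map_poly const_fract (char_poly (A_alpha \<alpha> G)))
      (to_fract [:0, 1:] - const_fract (\<alpha> * q) - (const_fract (1 - \<alpha>))\<^sup>2 * \<chi>)
    * det (block_diag_mat n q (\<lambda>i. coronal_mat \<alpha> (H (Suc i))))"
proof -
  let ?X = "to_fract [:0, 1:] :: real poly fract"
  let ?b = "- const_fract (1 - \<alpha>)"
  let ?M = "\<lambda>i. coronal_mat \<alpha> (H (Suc i))"
  let ?E = "block_ones_mat n q :: real poly fract mat"
  let ?D = "block_diag_mat n q ?M"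
  let ?N = "n + n * q"
  define AG where "AG = mat n n (\<lambda>(i, j). alpha_entry \<alpha> G (g (Suc i)) (g (Suc j)))"
  define AC where "AC = mat ?N ?N (\<lambda>(i, j). alpha_entry \<alpha> C (C_vertex i) (C_vertex j))"
  define A where "A = (?X - const_fract (\<alpha> * q)) \<cdot>\<^sub>m 1\<^sub>m n - map_mat const_fract AG"
  have AG: "AG \<in> carrier_mat n n" and AC: "AC \<in> carrier_mat ?N ?N" and A: "A \<in> carrier_mat n n"
    by (auto simp: AG_def AC_def A_def minus_carrier_mat)
  have pG: "char_poly (A_alpha \<alpha> G) = char_poly AG"
    using char_poly_A_alpha[of G "\<lambda>k. g (Suc k)" \<alpha>] bij_betw_g_Suc by (simp add: AG_def card_G)
  have pC: "char_poly (A_alpha \<alpha> C) = char_poly AC"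
    using char_poly_A_alpha[OF _ bij_betw_C_vertex, of \<alpha>] by (simp add: AC_def card_C)
  have blocks: "?X \<cdot>\<^sub>m 1\<^sub>m ?N - map_mat const_fract AC
      = four_block_mat A (?b \<cdot>\<^sub>m transpose_mat ?E) (?b \<cdot>\<^sub>m ?E) ?D"
  proof (rule eq_matI)
    fix k l
    assume "k < dim_row (four_block_mat A (?b \<cdot>\<^sub>m transpose_mat ?E) (?b \<cdot>\<^sub>m ?E) ?D)"
      and "l < dim_col (four_block_mat A (?b \<cdot>\<^sub>m transpose_mat ?E) (?b \<cdot>\<^sub>m ?E) ?D)"
    then have kl: "k < ?N" "l < ?N"
      using A by (auto simp: block_diag_mat_def)
    have outer: "Suc k \<in> {1..n}" if "k < n" for k using that by simp
    have inner: "Suc ((k - n) div q) \<in> {1..n}" "(k - n) mod q < q" "(k - n) div q < n" "k - n < n * q"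
      "vertex_list (H (Suc ((k - n) div q))) ! ((k - n) mod q) \<in> pverts (H (Suc ((k - n) div q)))"
      if "\<not> k < n" "k < ?N" for k
    proof -
      show *: "k - n < n * q" using that by auto
      then show d: "(k - n) div q < n" and m: "(k - n) mod q < q"
        by (auto simp: less_mult_imp_div_less intro!: mod_less_divisor gr0I)
      then show i: "Suc ((k - n) div q) \<in> {1..n}" by simp
      show "vertex_list (H (Suc ((k - n) div q))) ! ((k - n) mod q) \<in> pverts (H (Suc ((k - n) div q)))"
        using bij_betwE[OF H_vertices[OF i]] m by simp
    qed
    have lhs: "(?X \<cdot>\<^sub>m 1\<^sub>m ?N - map_mat const_fract AC) $$ (k, l)
        = (if k = l then ?X else 0) - const_fract (alpha_entry \<alpha> C (C_vertex k) (C_vertex l))"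
      using kl by (simp add: AC_def)
    show "(?X \<cdot>\<^sub>m 1\<^sub>m ?N - map_mat const_fract AC) $$ (k, l)
        = four_block_mat A (?b \<cdot>\<^sub>m transpose_mat ?E) (?b \<cdot>\<^sub>m ?E) ?D $$ (k, l)"
    proof (cases "k < n"; cases "l < n")
      assume k: "k < n" and l: "l < n"
      then show ?thesis
        unfolding lhs using A g_eq_iff[of "Suc k" "Suc l"]
        by (simp add: C_vertex_def alpha_entry_C(1)[OF outer[OF k]] A_def AG_def const_fract_simps
            del: index_one_mat) (simp add: block_diag_mat_def)
    next
      assume k: "k < n" and l: "\<not> l < n"
      show ?thesis
        unfolding lhs using A k l kl inner(3,4)[OF l kl(2)]
          alpha_entry_C(2)[OF outer[OF k] inner(1)[OF l kl(2)] inner(5)[OF l kl(2)]]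
        by (auto simp: C_vertex_def Let_def block_diag_mat_def block_ones_mat_def const_fract_simps)
    next
      assume k: "\<not> k < n" and l: "l < n"
      show ?thesis
        unfolding lhs using A k l kl inner(3,4)[OF k kl(1)]
          alpha_entry_C(3)[OF outer[OF l] inner(1)[OF k kl(1)] inner(5)[OF k kl(1)]]
        by (auto simp: C_vertex_def Let_def block_diag_mat_def block_ones_mat_def const_fract_simps)
    next
      assume k: "\<not> k < n" and l: "\<not> l < n"
      define i r j s where "i = (k - n) div q" and "r = (k - n) mod q"
        and "j = (l - n) div q" and "s = (l - n) mod q"
      note defs = this
      note ir = inner[OF k kl(1), folded defs] and js = inner[OF l kl(2), folded defs]
      have eq: "k = l \<longleftrightarrow> i = j \<and> r = s"
        using k l unfolding defs by (metis div_mult_mod_eq le_add_diff_inverse not_less)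
      have "?D $$ (k - n, l - n)
          = (if i = j then coronal_mat \<alpha> (H (Suc i)) $$ (r, s) else 0)"
        using ir(4) js(4) by (simp add: block_diag_mat_def defs)
      also have "\<dots> = (if k = l then ?X else 0)
          - const_fract (alpha_entry \<alpha> C (C_vertex k) (C_vertex l))"
      proof (cases "i = j")
        case True
        have "vertex_list (H (Suc i)) ! r = vertex_list (H (Suc i)) ! s \<longleftrightarrow> r = s"
          using bij_betw_imp_inj_on[OF H_vertices[OF ir(1)]] ir(2) js(2) by (auto dest: inj_onD)
        moreover have "C_vertex k = Inr (Suc i, vertex_list (H (Suc i)) ! r)"
          and "C_vertex l = Inr (Suc i, vertex_list (H (Suc i)) ! s)"
          using k l True by (simp_all add: C_vertex_def Let_def defs)
        ultimately show ?thesis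
          using True eq coronal_mat_index[OF ir(1,2) js(2), of \<alpha>]
            alpha_entry_C(4)[OF ir(1,5), of \<alpha> "Suc i" "vertex_list (H (Suc i)) ! s"]
          by (cases "r = s") (simp_all add: const_fract_simps)
      next
        case False
        have "C_vertex k = Inr (Suc i, vertex_list (H (Suc i)) ! r)"
          and "C_vertex l = Inr (Suc j, vertex_list (H (Suc j)) ! s)"
          using k l by (simp_all add: C_vertex_def Let_def defs)
        then show ?thesis
          using False eq
            alpha_entry_C(4)[OF ir(1,5), of \<alpha> "Suc j" "vertex_list (H (Suc j)) ! s"]
          by (simp add: const_fract_simps)
      qed
      also have "?D $$ (k - n, l - n)
          = four_block_mat A (?b \<cdot>\<^sub>m transpose_mat ?E) (?b \<cdot>\<^sub>m ?E) ?D $$ (k, l)"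
        using A k l kl by (simp add: block_diag_mat_def)
      finally show ?thesis unfolding lhs by simp
    qed
  qed (use A in \<open>auto simp: AC_def block_diag_mat_def\<close>)
  have "\<exists>x. x \<in> carrier_vec q \<and> ?M i *\<^sub>v x = vec q (\<lambda>_. 1) \<and> vec q (\<lambda>_. 1) \<bullet> x = \<chi>"
    if "i < n" for i
  proof -
    have i: "Suc i \<in> {1..n}" using that by simp
    show ?thesis
      using coronal_witness[of "H (Suc i)" \<alpha>] coronal[OF i] card_H[OF i] by metis
  qed
  then obtain x where x: "\<And>i. i < n \<Longrightarrow> x i \<in> carrier_vec q \<and> ?M i *\<^sub>v x i = vec q (\<lambda>_. 1)
      \<and> vec q (\<lambda>_. 1) \<bullet> x i = \<chi>"
    by metis
  have "to_fract (char_poly (A_alpha \<alpha> C))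
      = det (four_block_mat A (?b \<cdot>\<^sub>m transpose_mat ?E) (?b \<cdot>\<^sub>m ?E) ?D)"
    unfolding pC to_fract_char_poly[OF AC] blocks ..
  also have "\<dots> = det (A - (?b\<^sup>2 * \<chi>) \<cdot>\<^sub>m 1\<^sub>m n) * det ?D"
  proof (rule det_block_diag_bordered[OF A])
    show "?M i \<in> carrier_mat q q" if "i < n" for i
      using that card_H[of "Suc i"] coronal_mat_carrier[of \<alpha> "H (Suc i)"] by simp
  qed (use x in blast)+
  also have "A - (?b\<^sup>2 * \<chi>) \<cdot>\<^sub>m 1\<^sub>m n
      = (?X - const_fract (\<alpha> * q) - (const_fract (1 - \<alpha>))\<^sup>2 * \<chi>) \<cdot>\<^sub>m 1\<^sub>m n - map_mat const_fract AG"
    by (rule eq_matI) (auto simp: A_def AG_def)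
  also have "det \<dots> = poly (char_poly (map_mat const_fract AG))
      (?X - const_fract (\<alpha> * q) - (const_fract (1 - \<alpha>))\<^sup>2 * \<chi>)"
    by (rule poly_char_poly[symmetric]) (use AG in simp)
  also have "char_poly (map_mat const_fract AG) = map_poly const_fract (char_poly (A_alpha \<alpha> G))"
    unfolding pG by (rule const_fract.char_poly_hom[OF AG])
  finally show ?thesis .
qed

end

theorem corollary3p3:
  fixes \<alpha> :: real and n q :: nat
    and G\<^sub>1 :: "'a pair_pre_digraph" and G\<^sub>2 :: "'b pair_pre_digraph"
    and g\<^sub>1 :: "nat \<Rightarrow> 'a" and g\<^sub>2 :: "nat \<Rightarrow> 'b"
    and H :: "nat \<Rightarrow> 'c pair_pre_digraph"
  assumes "0 \<le> \<alpha>" and "\<alpha> \<le> 1"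
    and "pair_graph G\<^sub>1" and "pair_graph G\<^sub>2"
    and "card (pverts G\<^sub>1) = n" and "card (pverts G\<^sub>2) = n"
    and "bij_betw g\<^sub>1 {1..n} (pverts G\<^sub>1)" and "bij_betw g\<^sub>2 {1..n} (pverts G\<^sub>2)"
    and "A_alpha_cospectral \<alpha> G\<^sub>1 G\<^sub>2"
    and "\<And>i. i \<in> {1..n} \<Longrightarrow> pair_graph (H i)"
    and "\<And>i. i \<in> {1..n} \<Longrightarrow> card (pverts (H i)) = q"
    and "\<And>i j. i \<in> {1..n} \<Longrightarrow> j \<in> {1..n} \<Longrightarrow> A_alpha_coronal \<alpha> (H i) = A_alpha_coronal \<alpha> (H j)"
  shows "A_alpha_cospectral \<alpha> (generalized_corona G\<^sub>1 g\<^sub>1 H) (generalized_corona G\<^sub>2 g\<^sub>2 H)"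
proof -
  interpret A: corona_data G\<^sub>1 g\<^sub>1 H n q by (rule corona_data.intro) (fact assms)+
  interpret B: corona_data G\<^sub>2 g\<^sub>2 H n q by (rule corona_data.intro) (fact assms)+
  \<comment> \<open>for \<open>n = 0\<close> nothing is known about \<open>H 1\<close>, but then there is no \<open>i\<close>\<close>
  have coronal: "A_alpha_coronal \<alpha> (H i) = A_alpha_coronal \<alpha> (H 1)" if "i \<in> {1..n}" for i
    using that by (intro assms(12)) auto
  have "char_poly (A_alpha \<alpha> G\<^sub>1) = char_poly (A_alpha \<alpha> G\<^sub>2)"
    using assms(9) by (simp add: A_alpha_cospectral_def A_alpha_spectrum_eq_iff)
  then have "to_fract (char_poly (A_alpha \<alpha> A.C)) = to_fract (char_poly (A_alpha \<alpha> B.C))"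
    by (simp only: A.to_fract_char_poly_generalized_corona[OF coronal]
        B.to_fract_char_poly_generalized_corona[OF coronal])
  then have "A_alpha_spectrum \<alpha> A.C = A_alpha_spectrum \<alpha> B.C"
    by (simp add: A_alpha_spectrum_eq_iff)
  moreover have "\<not> digraph_iso (with_proj A.C) (with_proj B.C)"
    using digraph_iso_of_generalized_coronas[OF A.corona_data_axioms B.corona_data_axioms] assms(9)
    by (auto simp: A_alpha_cospectral_def)
  ultimately show ?thesis by (simp add: A_alpha_cospectral_def)
qed

end
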